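(* Fix a finite set $\Lambda$, an integer $d\geq1$, polynomials $P_1,\dots,P_k\in\mathbb{R}[x_1,\dots,x_d,y_1,\dots,y_d]$, a function $\phi:\{+,-,0\}^k\to\Lambda$, and a non-empty open subset $U\subseteq\mathbb{R}^d$ which is definable by polynomials. Suppose that for any two distinct points $a,a'\in U$ there exists $b\in U$ with $P_s(a,b)\neq0$ and $P_s(a',b)\neq0$ for all $1\le s\le k$ and $$\phi(\operatorname{sgn}P_1(a,b),\dots,\operatorname{sgn}P_k(a,b))\neq\phi(\operatorname{sgn}P_1(a',b),\dots,\operatorname{sgn}P_k(a',b)).$$ Then there are at least $n^{(1-o(1))dn}$ strongly $(P_1,\dots,P_k,\phi,U,\Lambda)$-representable edge-labelings of the complete graph on the vertex set $\{1,\dots,n\}$, where the $o(1)$ term tends to $0$ as $n\to\infty$.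
   Context: For a real number $x$, $\operatorname{sgn}(x)\in\{+,-,0\}$ is its sign (with $\operatorname{sgn}(0)=0$). An edge-labeling of a graph $G$ with labels in $\Lambda$ is a function $E(G)\to\Lambda$. For points $a_1,\dots,a_n\in U$, $F_{P_1,\dots,P_k,\phi}(a_1,\dots,a_n)$ is the edge-labeling of the complete graph on $\{1,\dots,n\}$ in which, for $1\le i<j\le n$, the edge $ij$ gets the label $\phi(\operatorname{sgn}P_1(a_i,a_j),\dots,\operatorname{sgn}P_k(a_i,a_j))$; here $P_s(a,b)$ denotes evaluation at $(a,b)\in\mathbb{R}^{2d}$. An edge-labeling of the complete graph on $\{1,\dots,n\}$ is strongly $(P_1,\dots,P_k,\phi,U,\Lambda)$-representable if it equals $F_{P_1,\dots,P_k,\phi}(a_1,\dots,a_n)$ for some $a_1,\dots,a_n\in U$ such that $P_s(a_i,a_j)\neq0$ for all $1\le i<j\le n$ and all $1\le s\le k$. A subset $U\subseteq\mathbb{R}^d$ is definable by polynomials if there are real polynomials $Q_1,\dots,Q_\ell$ in $d$ variables and a set $S\subseteq\{+,-,0\}^\ell$ with $U=\{x\in\mathbb{R}^d:(\operatorname{sgn}Q_1(x),\dots,\operatorname{sgn}Q_\ell(x))\in S\}$. *)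

theory Defs
  imports "HOL-Analysis.Analysis" "HOL-Library.FuncSet"
begin

inductive polyfun :: "('v \<Rightarrow> real) set \<Rightarrow> ('v \<Rightarrow> real) \<Rightarrow> bool" for C where
  pconst: "polyfun C (\<lambda>x. c)"
| pcoord: "g \<in> C \<Longrightarrow> polyfun C g"
| padd: "polyfun C f \<Longrightarrow> polyfun C g \<Longrightarrow> polyfun C (\<lambda>x. f x + g x)"
| pmult: "polyfun C f \<Longrightarrow> polyfun C g \<Longrightarrow> polyfun C (\<lambda>x. f x * g x)"

definition poly_Rd :: "(real^'d \<Rightarrow> real) \<Rightarrow> bool" where
  "poly_Rd f \<longleftrightarrow> polyfun (range (\<lambda>i x. x $ i)) f"

definition poly_R2d :: "((real^'d) \<times> (real^'d) \<Rightarrow> real) \<Rightarrow> bool" where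
  "poly_R2d f \<longleftrightarrow> polyfun (range (\<lambda>i p. fst p $ i) \<union> range (\<lambda>i p. snd p $ i)) f"

datatype sign = Pos | Neg | Zero

definition sgnr :: "real \<Rightarrow> sign" where
  "sgnr x = (if x > 0 then Pos else if x < 0 then Neg else Zero)"

definition definable_by_polys :: "(real^'d) set \<Rightarrow> bool" where
  "definable_by_polys U \<longleftrightarrow>
     (\<exists>(l::nat) (Q :: nat \<Rightarrow> real^'d \<Rightarrow> real) (S :: sign list set).
        (\<forall>j<l. poly_Rd (Q j)) \<and>
        U = {x. map (\<lambda>j. sgnr (Q j x)) [0..<l] \<in> S})"

definition signvec :: "nat \<Rightarrow> (nat \<Rightarrow> (real^'d) \<times> (real^'d) \<Rightarrow> real) \<Rightarrow> real^'d \<Rightarrow> real^'d \<Rightarrow> sign list" where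
  "signvec k P a b = map (\<lambda>s. sgnr (P s (a, b))) [0..<k]"

definition edges :: "nat \<Rightarrow> (nat \<times> nat) set" where
  "edges n = {(i, j). 1 \<le> i \<and> i < j \<and> j \<le> n}"

definition strongly_rep :: "nat \<Rightarrow> (nat \<Rightarrow> (real^'d) \<times> (real^'d) \<Rightarrow> real) \<Rightarrow> (sign list \<Rightarrow> 'l)
     \<Rightarrow> (real^'d) set \<Rightarrow> nat \<Rightarrow> (nat \<times> nat \<Rightarrow> 'l) set" where
  "strongly_rep k P \<phi> U n =
     {(\<lambda>e\<in>edges n. \<phi> (signvec k P (a (fst e)) (a (snd e)))) | a.
        (\<forall>i\<in>{1..n}. a i \<in> U) \<and>
        (\<forall>(i, j)\<in>edges n. \<forall>s<k. P s (a i, a j) \<noteq> 0)}"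

end

theory Submission
  imports Defs "HOL-Probability.Probability_Measure" "HOL-Real_Asymp.Real_Asymp"
begin

text \<open>
  Fix a probability measure on \<open>b \<in> U\<close> with a density, and let \<open>\<rho> a a'\<close> be the probability that
  \<open>b\<close> gives \<open>a\<close> and \<open>a'\<close> different labels. The zero set of a nonzero polynomial is null, so \<open>\<rho>\<close> is a
  continuous pseudometric; the separation hypothesis makes it bounded below between opposite faces
  of any cube in \<open>U\<close>. Mapping a point of the cube to its \<open>\<rho>\<close>-distances from the \<open>d\<close> lower faces and
  applying the Poincare--Miranda theorem yields, for every \<open>r\<close>, a set of \<open>r^d\<close> points whose pairwise
  \<open>\<rho>\<close>-distances are at least a constant over \<open>r\<close>. Hence \<open>O(r log r)\<close> points \<open>b\<close>, chosen greedily,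
  distinguish all of them.

  Take these \<open>m\<close> points \<open>b\<close> as the last \<open>m\<close> vertices and let each of the first \<open>n - m\<close> vertices be
  an arbitrary one of the \<open>r^d\<close> points. After a small perturbation making all \<open>P_s\<close> nonzero, this
  gives \<open>r^(d(n - m))\<close> different labelings; choose \<open>r\<close> of order \<open>n / (log n)^3\<close> and \<open>m\<close> of
  order \<open>n / log n\<close>.
\<close>

section \<open>Zero sets of polynomials\<close>

text \<open>Applied with \<open>\<gamma>\<close> a line, this turns a polynomial in many variables
  into a univariate one, which has finitely many roots unless it vanishes identically.\<close>

lemma polyfun_comp_poly:
  assumes "polyfun C f" and "\<And>g. g \<in> C \<Longrightarrow> \<exists>p. \<forall>t. g (\<gamma> t) = poly p t"
  shows "\<exists>p. \<forall>t. f (\<gamma> t) = poly p t"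
  using assms(1)
proof induction
  case (pconst c)
  show ?case by (rule exI[of _ "[:c:]"]) simp
next
  case (pcoord g)
  then show ?case by (rule assms(2))
next
  case (padd f g)
  then obtain p q where "\<forall>t. f (\<gamma> t) = poly p t" "\<forall>t. g (\<gamma> t) = poly q t" by blast
  then show ?case by (intro exI[of _ "p + q"]) simp
next
  case (pmult f g)
  then obtain p q where "\<forall>t. f (\<gamma> t) = poly p t" "\<forall>t. g (\<gamma> t) = poly q t" by blast
  then show ?case by (intro exI[of _ "p * q"]) simp
qed

lemma polyfun_continuous_on:
  assumes "polyfun C f" and "\<And>g. g \<in> C \<Longrightarrow> continuous_on S g"
  shows "continuous_on S f"
  using assms by induction (auto intro: continuous_intros)

lemma poly_R2d_continuous_on: "poly_R2d f \<Longrightarrow> continuous_on S f"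
  unfolding poly_R2d_def
  by (erule polyfun_continuous_on) (auto intro!: continuous_intros)

lemma poly_R2d_snd_line:
  fixes f :: "(real^'d) \<times> (real^'d) \<Rightarrow> real"
  assumes "poly_R2d f"
  shows "\<exists>p. \<forall>t. f (a, b + t *\<^sub>R v) = poly p t"
proof -
  have "\<exists>p. \<forall>t. g (a, b + t *\<^sub>R v) = poly p t"
    if g: "g \<in> range (\<lambda>i p. fst p $ i) \<union> range (\<lambda>i p. snd p $ i)" for g :: "(real^'d) \<times> (real^'d) \<Rightarrow> real"
  proof -
    from g consider i where "g = (\<lambda>p. fst p $ i)" | i where "g = (\<lambda>p. snd p $ i)" by blast
    then show ?thesis
    proof cases
      case 1
      then show ?thesis by (intro exI[of _ "[:a $ i:]"]) simp
    next
      case 2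
      then show ?thesis by (intro exI[of _ "[:b $ i, v $ i:]"]) simp
    qed
  qed
  then show ?thesis
    using polyfun_comp_poly[of _ f "\<lambda>t. (a, b + t *\<^sub>R v)"] assms unfolding poly_R2d_def by blast
qed

text \<open>Nonempty open sets are not Lebesgue null. This is how almost-everywhere statements
  become points chosen inside a prescribed neighbourhood.\<close>

lemma AE_lborel_open_ex:
  fixes V :: "'a::euclidean_space set"
  assumes "AE x in lborel. G x" "open V" "V \<noteq> {}"
  shows "\<exists>x\<in>V. G x"
proof (rule ccontr)
  assume no: "\<not> (\<exists>x\<in>V. G x)"
  have "AE x in lborel. x \<notin> V"
    using assms(1) by eventually_elim (use no in auto)
  then have "V \<in> null_sets lborel"
    using \<open>open V\<close> by (simp add: AE_iff_null_sets)
  then have "negligible V"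
    by (metis null_sets_completionI negligible_iff_null_sets)
  then show False using open_not_negligible assms by blast
qed

text \<open>Each line through \<open>x0\<close> meets the zero set in finitely many points, so by Fubini almost
  every dilate of the zero set about \<open>x0\<close> is null; all dilates are null or none is.\<close>
lemma AE_nonzero_if_poly_on_lines:
  fixes f :: "'a::euclidean_space \<Rightarrow> real"
  assumes cont: "continuous_on UNIV f"
    and nz: "f x0 \<noteq> 0"
    and line: "\<And>v. \<exists>p. \<forall>t. f (x0 + t *\<^sub>R v) = poly p t"
  shows "AE x in lborel. f x \<noteq> 0"
proof -
  have meas[measurable]: "f \<in> borel_measurable borel"
    using cont by (simp add: borel_measurable_continuous_onI)
  have "AE t in lborel. f (x0 + t *\<^sub>R v) \<noteq> 0" for v
  proof -
    obtain p where p: "\<And>t. f (x0 + t *\<^sub>R v) = poly p t" using line by blast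
    \<comment> \<open>All lines pass through \<open>x0\<close>, where \<open>f\<close> does not
      vanish, so no restriction to a line is the zero polynomial.\<close>
    have "poly p 0 \<noteq> 0" using p[of 0] nz by simp
    then have "finite {t. poly p t = 0}" by (intro poly_roots_finite) auto
    then have "{t. poly p t = 0} \<in> null_sets lborel"
      by (rule finite_imp_null_set_lborel)
    then show ?thesis
      by (rule AE_I') (auto simp: p)
  qed
  then have "AE v in lborel. AE t in lborel. f (x0 + t *\<^sub>R v) \<noteq> 0" by simp
  moreover have "{x \<in> space (lborel \<Otimes>\<^sub>M lborel). f (x0 + snd x *\<^sub>R fst x) \<noteq> 0}
      \<in> sets (lborel \<Otimes>\<^sub>M lborel)"
    by measurable
  moreover have "pair_sigma_finite (lborel :: 'a measure) (lborel :: real measure)" ..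
  ultimately have "AE t in lborel. AE v in lborel. f (x0 + t *\<^sub>R v) \<noteq> 0"
    using pair_sigma_finite.AE_commute[of lborel lborel "\<lambda>v t. f (x0 + t *\<^sub>R v) \<noteq> 0"] by simp
  moreover have "AE t in lborel. t \<noteq> (0::real)"
    by (rule AE_lborel_singleton)
  ultimately have "AE t in lborel. t \<noteq> 0 \<and> (AE v in lborel. f (x0 + t *\<^sub>R v) \<noteq> 0)"
    by eventually_elim auto
  then obtain t :: real where t: "t \<noteq> 0" "AE v in lborel. f (x0 + t *\<^sub>R v) \<noteq> 0"
    using AE_lborel_open_ex[of _ UNIV] by blast
  \<comment> \<open>The image of Lebesgue measure under this dilation, rescaled by the Jacobian
    \<open>\<bar>t\<bar>^DIM('a)\<close>, is Lebesgue measure again. This is where \<open>t\<close>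
    must be nonzero.\<close>
  have "AE x in density (distr lborel borel (\<lambda>x. x0 + t *\<^sub>R x)) (\<lambda>_. \<bar>t\<bar>^DIM('a)). f x \<noteq> 0"
    using t by (subst AE_density, simp, subst AE_distr_iff) auto
  then show ?thesis
    by (subst lborel_affine[OF t(1), of x0])
qed

section \<open>Local constancy and measurability of labels\<close>

lemma eventually_sgnr_eq:
  assumes "isCont f z" "f z \<noteq> (0::real)"
  shows "\<forall>\<^sub>F x in nhds z. sgnr (f x) = sgnr (f z)"
proof -
  have lim: "(f \<longlongrightarrow> f z) (nhds z)"
    using assms(1) by (simp add: isCont_def tendsto_at_iff_tendsto_nhds)
  show ?thesis
  proof (cases "f z > 0")
    case True
    from order_tendstoD(1)[OF lim True] show ?thesis
      by eventually_elim (use True in \<open>auto simp: sgnr_def\<close>)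
  next
    case False
    then have n: "f z < 0" using assms(2) by simp
    from order_tendstoD(2)[OF lim n] show ?thesis
      by eventually_elim (use n in \<open>auto simp: sgnr_def\<close>)
  qed
qed

lemma signvec_eq_iff: "signvec k P a b = signvec k P a' b' \<longleftrightarrow>
    (\<forall>s<k. sgnr (P s (a, b)) = sgnr (P s (a', b')))"
  by (auto simp: signvec_def)

text \<open>This is the condition that strong representability puts on each edge. For polynomial
  \<open>P\<close>, the sign vector is locally constant in both arguments wherever it holds.\<close>

definition nondeg :: "nat \<Rightarrow> (nat \<Rightarrow> (real^'d) \<times> (real^'d) \<Rightarrow> real) \<Rightarrow> real^'d \<Rightarrow> real^'d \<Rightarrow> bool" where
  "nondeg k P a b \<longleftrightarrow> (\<forall>s<k. P s (a, b) \<noteq> 0)"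

lemma eventually_signvec_eq:
  assumes "\<forall>s<k. poly_R2d (P s)" "nondeg k P a b"
  shows "\<forall>\<^sub>F z in nhds (a, b). signvec k P (fst z) (snd z) = signvec k P a b"
proof -
  have "\<forall>\<^sub>F z in nhds (a, b). \<forall>s\<in>{..<k}. sgnr (P s z) = sgnr (P s (a, b))"
  proof (rule eventually_ball_finite, simp, rule ballI, rule eventually_sgnr_eq)
    fix s assume "s \<in> {..<k}"
    then show "isCont (P s) (a, b)"
      using assms poly_R2d_continuous_on[of "P s" UNIV] by (auto simp: continuous_on_eq_continuous_at)
    show "P s (a, b) \<noteq> 0" using assms \<open>s \<in> {..<k}\<close> by (auto simp: nondeg_def)
  qed
  then show ?thesis by eventually_elim (simp add: signvec_eq_iff)
qed

text \<open>The single partner \<open>b0\<close> shows that none of the finitely many polynomials in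
  \<open>b\<close> obtained by fixing \<open>a\<close> is identically zero, so their zero sets are
  null.\<close>

lemma AE_nondeg:
  assumes polys: "\<forall>s<k. poly_R2d (P s)" and "nondeg k P a b0"
  shows "AE b in lborel. nondeg k P a b"
proof -
  have "AE b in lborel. P s (a, b) \<noteq> 0" if "s < k" for s
  proof (rule AE_nonzero_if_poly_on_lines)
    have "continuous_on UNIV (P s \<circ> Pair a)"
      by (intro continuous_on_compose continuous_intros poly_R2d_continuous_on)
        (use polys that in auto)
    then show "continuous_on UNIV (\<lambda>b. P s (a, b))" by (simp add: o_def)
    show "P s (a, b0) \<noteq> 0" using assms that by (auto simp: nondeg_def)
    show "\<exists>p. \<forall>t. P s (a, b0 + t *\<^sub>R v) = poly p t" for v
      by (rule poly_R2d_snd_line) (use polys that in auto)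
  qed
  then have "AE b in lborel. \<forall>s\<in>{..<k}. P s (a, b) \<noteq> 0"
    by (intro AE_finite_allI) auto
  then show ?thesis by eventually_elim (auto simp: nondeg_def)
qed

text \<open>There are finitely many sign vectors of length \<open>k\<close>, and each is attained on
  a finite intersection of Borel sign conditions.\<close>

lemma measurable_label:
  fixes \<phi> :: "sign list \<Rightarrow> 'l::finite"
  assumes "\<forall>s<k. poly_R2d (P s)"
  shows "(\<lambda>b. \<phi> (signvec k P a b)) \<in> borel \<rightarrow>\<^sub>M count_space UNIV"
proof -
  have fin: "finite {l :: sign list. length l = k}"
    using finite_lists_length_eq[of "{Pos, Neg, Zero}" k]
    by (rule rev_finite_subset) (auto intro: sign.exhaust)
  have "{b. signvec k P a b = l} \<in> sets borel" if "length l = k" for l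
  proof -
    have "{b. sgnr (P s (a, b)) = l ! s} \<in> sets borel" if "s < k" for s
    proof -
      have "continuous_on UNIV (P s \<circ> Pair a)"
        by (intro continuous_on_compose continuous_intros poly_R2d_continuous_on)
          (use assms that in auto)
      then have [measurable]: "(\<lambda>b. P s (a, b)) \<in> borel_measurable borel"
        by (simp add: o_def borel_measurable_continuous_onI)
      show ?thesis
        unfolding sgnr_def by (cases "l ! s") measurable
    qed
    then have "{b. \<forall>s\<in>{..<k}. sgnr (P s (a, b)) = l ! s} \<in> sets borel"
      using sets.sets_Collect_finite_All[of "{..<k}" borel "\<lambda>s b. sgnr (P s (a, b)) = l ! s"]
      by simp
    moreover have "{b. signvec k P a b = l} = {b. \<forall>s\<in>{..<k}. sgnr (P s (a, b)) = l ! s}"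
      using that by (auto simp: signvec_def list_eq_iff_nth_eq)
    ultimately show ?thesis by simp
  qed
  then have "(\<Union>l\<in>{l. length l = k \<and> \<phi> l = c}. {b. signvec k P a b = l}) \<in> sets borel" for c
    by (intro sets.finite_UN) (auto intro: finite_subset[OF _ fin])
  moreover have "(\<lambda>b. \<phi> (signvec k P a b)) -` {c} =
      (\<Union>l\<in>{l. length l = k \<and> \<phi> l = c}. {b. signvec k P a b = l})" for c
    by (auto simp: signvec_def)
  ultimately show ?thesis
    by (subst measurable_count_space_eq2) auto
qed

section \<open>Separated points in a cube\<close>

text \<open>Brouwer's theorem gives a fixed point of \<open>x - (f x - y)\<close> clipped to the
  box; the face conditions make the clipping harmless there.\<close>

lemma poincare_miranda:
  fixes f :: "real^'d \<Rightarrow> real^'d"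
  assumes lt: "\<And>i. p $ i < q $ i"
    and cont: "continuous_on (cbox p q) f"
    and lower: "\<And>x i. x \<in> cbox p q \<Longrightarrow> x $ i = p $ i \<Longrightarrow> f x $ i \<le> y $ i"
    and upper: "\<And>x i. x \<in> cbox p q \<Longrightarrow> x $ i = q $ i \<Longrightarrow> y $ i \<le> f x $ i"
  shows "\<exists>x\<in>cbox p q. f x = y"
proof -
  define g where "g x = (\<chi> i. max (p $ i) (min (q $ i) (x $ i - (f x $ i - y $ i))))" for x
  have ne: "cbox p q \<noteq> {}"
    using lt by (auto simp: interval_ne_empty_cart less_imp_le)
  have contg: "continuous_on (cbox p q) g"
    unfolding g_def by (intro continuous_intros continuous_on_vec_lambda cont)
  have im: "g \<in> cbox p q \<rightarrow> cbox p q"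
    using lt by (auto simp: g_def mem_box_cart less_imp_le)
  obtain x where x: "x \<in> cbox p q" "g x = x"
    using brouwer[OF compact_cbox convex_box(1) ne contg im] by blast
  have "f x $ i = y $ i" for i
  proof -
    have fix_i: "x $ i = max (p $ i) (min (q $ i) (x $ i - (f x $ i - y $ i)))"
      by (subst (1) x(2)[symmetric]) (simp add: g_def)
    show ?thesis
      \<comment> \<open>Strictly between the faces the clipping is inactive, so the displacement
        \<open>f x $ i - y $ i\<close> is zero. On a face, the fixed-point equation and the face
        condition bound the displacement from opposite sides by zero.\<close>
      using fix_i lower[OF x(1), of i] upper[OF x(1), of i] lt[of i]
      by (auto simp: max_def min_def split: if_splits)
  qed
  then show ?thesis using x(1) by (auto simp: vec_eq_iff)
qed

text \<open>The coordinates \<open>f\<close> below are the \<open>\<rho>\<close>-distances to the lower faces of the cube. They are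
  1-Lipschitz for \<open>\<rho>\<close>, and by Poincare--Miranda they attain every value in \<open>[0, \<kappa>]^d\<close>.\<close>
lemma separated_subset_of_cube:
  fixes \<rho> :: "real^'d \<Rightarrow> real^'d \<Rightarrow> real"
  assumes lt: "\<And>i. p $ i < q $ i"
    and nonneg: "\<And>x y. 0 \<le> \<rho> x y"
    and refl: "\<And>x. \<rho> x x = 0"
    and sym: "\<And>x y. \<rho> x y = \<rho> y x"
    and tri: "\<And>x y z. \<rho> x z \<le> \<rho> x y + \<rho> y z"
    and cont: "\<And>a. a \<in> cbox p q \<Longrightarrow> (\<rho> a \<longlongrightarrow> 0) (at a within cbox p q)"
    and \<kappa>: "0 < \<kappa>"
    and faces: "\<And>x y i. x \<in> cbox p q \<Longrightarrow> y \<in> cbox p q \<Longrightarrow> x $ i = p $ i \<Longrightarrow> y $ i = q $ i \<Longrightarrow> \<kappa> \<le> \<rho> x y"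
    and r: "0 < r"
  shows "\<exists>A \<subseteq> cbox p q. finite A \<and> card A = r ^ CARD('d) \<and>
           (\<forall>x\<in>A. \<forall>y\<in>A. x \<noteq> y \<longrightarrow> \<kappa> / real r \<le> \<rho> x y)"
proof -
  define F where "F i = {z \<in> cbox p q. z $ i = p $ i}" for i
  define f where "f x = (\<chi> i. INF z\<in>F i. \<rho> z x)" for x
  have pF: "p \<in> F i" for i
    using lt by (auto simp: F_def mem_box_cart less_imp_le)
  have bdd: "bdd_below ((\<lambda>z. \<rho> z x) ` F i)" for x i
    using nonneg by (intro bdd_belowI2[where m = 0]) auto
  have lip1: "f x $ i \<le> f y $ i + \<rho> x y" for x y i
  proof -
    have "f x $ i - \<rho> x y \<le> (INF z\<in>F i. \<rho> z y)"
    proof (rule cINF_greatest)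
      show "F i \<noteq> {}" using pF by blast
      fix z assume "z \<in> F i"
      then have "f x $ i \<le> \<rho> z x"
        unfolding f_def by (simp add: cINF_lower[OF bdd])
      then show "f x $ i - \<rho> x y \<le> \<rho> z y" using tri[of z x y] sym[of x y] by linarith
    qed
    then show ?thesis by (simp add: f_def)
  qed
  have lip: "\<bar>f x $ i - f y $ i\<bar> \<le> \<rho> x y" for x y i
    using lip1[of x i y] lip1[of y i x] sym[of x y] by linarith
  have "continuous_on (cbox p q) (\<lambda>x. f x $ i)" for i
    unfolding continuous_on_def
  proof
    fix a assume "a \<in> cbox p q"
    then have "(\<rho> a \<longlongrightarrow> 0) (at a within cbox p q)" by (rule cont)
    then have "((\<lambda>x. f x $ i - f a $ i) \<longlongrightarrow> 0) (at a within cbox p q)"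
      by (rule Lim_null_comparison[rotated]) (use lip sym in \<open>auto simp: always_eventually\<close>)
    then show "((\<lambda>x. f x $ i) \<longlongrightarrow> f a $ i) (at a within cbox p q)"
      by (simp add: LIM_zero_iff)
  qed
  then have contf: "continuous_on (cbox p q) f"
    using continuous_on_vec_lambda[of "cbox p q" "\<lambda>i x. f x $ i"] by simp
  \<comment> \<open>Each \<open>g\<close> encodes the target value with coordinates
    \<open>\<kappa> * g i / r\<close>. Two distinct targets differ by at least
    \<open>\<kappa> / r\<close> in some coordinate, and since \<open>f\<close> is 1-Lipschitz for
    \<open>\<rho>\<close> their preimages are at least that far apart.\<close>
  define Gs where "Gs = (PiE UNIV (\<lambda>_. {..<r}) :: ('d \<Rightarrow> nat) set)"
  have finG: "finite Gs" and cardG: "card Gs = r ^ CARD('d)"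
    unfolding Gs_def by (auto simp: card_PiE intro!: finite_PiE)
  have "\<exists>x\<in>cbox p q. f x = (\<chi> i. \<kappa> * real (g i) / real r)" if "g \<in> Gs" for g
  proof (rule poincare_miranda[OF lt contf])
    fix x i assume x: "x \<in> cbox p q"
    show "f x $ i \<le> (\<chi> i. \<kappa> * real (g i) / real r) $ i" if "x $ i = p $ i"
    proof -
      have "x \<in> F i" using x that by (simp add: F_def)
      then have "f x $ i \<le> \<rho> x x" unfolding f_def by (simp add: cINF_lower[OF bdd])
      also have "\<dots> = 0" by (rule refl)
      also have "\<dots> \<le> (\<chi> i. \<kappa> * real (g i) / real r) $ i" using \<kappa> by simp
      finally show ?thesis .
    qed
    show "(\<chi> i. \<kappa> * real (g i) / real r) $ i \<le> f x $ i" if "x $ i = q $ i"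
    proof -
      have "g i \<le> r" using \<open>g \<in> Gs\<close> by (auto simp: Gs_def PiE_iff less_imp_le)
      then have "(\<chi> i. \<kappa> * real (g i) / real r) $ i \<le> \<kappa>"
        using \<kappa> r by (simp add: field_simps)
      also have "\<kappa> \<le> f x $ i"
        unfolding f_def vec_lambda_beta
        by (rule cINF_greatest) (use pF x that faces in \<open>auto simp: F_def\<close>)
      finally show ?thesis .
    qed
  qed
  then obtain h where h: "\<And>g. g \<in> Gs \<Longrightarrow> h g \<in> cbox p q"
    "\<And>g. g \<in> Gs \<Longrightarrow> f (h g) = (\<chi> i. \<kappa> * real (g i) / real r)" by metis
  have far: "\<kappa> / real r \<le> \<rho> (h g) (h g')" if "g \<in> Gs" "g' \<in> Gs" "g \<noteq> g'" for g g'
  proof -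
    obtain i where "g i \<noteq> g' i" using \<open>g \<noteq> g'\<close> by blast
    then have "1 \<le> \<bar>real (g i) - real (g' i)\<bar>" by linarith
    then have "\<kappa> / real r \<le> (\<kappa> / real r) * \<bar>real (g i) - real (g' i)\<bar>"
      using \<kappa> mult_left_mono[of 1 "\<bar>real (g i) - real (g' i)\<bar>" "\<kappa> / real r"] by simp
    also have "\<dots> = \<bar>(\<kappa> / real r) * (real (g i) - real (g' i))\<bar>"
      using \<kappa> r by (simp add: abs_mult)
    also have "\<dots> = \<bar>f (h g) $ i - f (h g') $ i\<bar>"
      using h(2) that by (simp add: right_diff_distrib)
    also have "\<dots> \<le> \<rho> (h g) (h g')" by (rule lip)
    finally show ?thesis .
  qed
  have "inj_on h Gs"
  proof (rule inj_onI, rule ccontr)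
    fix g g' assume "g \<in> Gs" "g' \<in> Gs" "h g = h g'" "g \<noteq> g'"
    then have "\<kappa> / real r \<le> 0" using far[of g g'] refl by simp
    then show False using \<kappa> r by (simp add: divide_le_0_iff)
  qed
  then have "card (h ` Gs) = r ^ CARD('d)" by (simp add: card_image cardG)
  moreover have "\<forall>x\<in>h ` Gs. \<forall>y\<in>h ` Gs. x \<noteq> y \<longrightarrow> \<kappa> / real r \<le> \<rho> x y"
    using far by blast
  ultimately show ?thesis using h(1) finG by (intro exI[of _ "h ` Gs"]) auto
qed

section \<open>Finite samples that separate all points of a finite set\<close>

text \<open>First moment method: the expected number of events that a random \<open>b\<close> misses
  is at most \<open>(1 - \<theta>) * card X\<close>, so it cannot be larger for almost every
  \<open>b\<close>.\<close>

lemma (in prob_space) ex_point_in_many_events: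
  assumes fin: "finite X" and D: "\<And>x. x \<in> X \<Longrightarrow> D x \<in> events" "\<And>x. x \<in> X \<Longrightarrow> \<theta> \<le> prob (D x)"
    and G: "AE b in M. G b"
  shows "\<exists>b. G b \<and> real (card {x\<in>X. b \<notin> D x}) \<le> (1 - \<theta>) * real (card X)"
proof (rule ccontr)
  assume "\<not> ?thesis"
  then have less: "(1 - \<theta>) * real (card X) < real (card {x\<in>X. b \<notin> D x})" if "G b" for b
    using that by force
  define c where "c b = (\<Sum>x\<in>X. indicator (space M - D x) b :: real)" for b
  have c: "c b = real (card {x\<in>X. b \<notin> D x})" if "b \<in> space M" for b
    using that fin unfolding c_def by (simp add: indicator_def sum.If_cases Int_def)
  have ev: "space M - D x \<in> events" if "x \<in> X" for x using D(1)[OF that] by auto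
  have int: "integrable M c"
    unfolding c_def using ev by (intro Bochner_Integration.integrable_sum) (auto simp: emeasure_eq_measure)
  have "AE b in M. (1 - \<theta>) * real (card X) < c b"
    using G AE_space by eventually_elim (simp add: c less)
  then have "(\<integral>b. (1 - \<theta>) * real (card X) \<partial>M) < (\<integral>b. c b \<partial>M)"
    by (intro integral_less_AE_space int) (auto simp: emeasure_space_1)
  also have "(\<integral>b. c b \<partial>M) = (\<Sum>x\<in>X. prob (space M - D x))"
    unfolding c_def using ev
    by (subst Bochner_Integration.integral_sum) (auto simp: emeasure_eq_measure)
  also have "\<dots> \<le> (\<Sum>x\<in>X. 1 - \<theta>)"
    using D by (intro sum_mono) (simp add: prob_compl)
  finally show False by (simp add: prob_space mult.commute)
qed

text \<open>Each new point is chosen for the events still missed and leaves at most the fraction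
  \<open>1 - \<theta>\<close> of them.\<close>

lemma (in prob_space) greedy_hitting_set:
  assumes fin: "finite X" and D: "\<And>x. x \<in> X \<Longrightarrow> D x \<in> events" "\<And>x. x \<in> X \<Longrightarrow> \<theta> \<le> prob (D x)"
    and \<theta>: "\<theta> \<le> 1" and G: "AE b in M. G b"
  shows "\<exists>b. (\<forall>j<m. G (b j)) \<and> real (card {x\<in>X. \<forall>j<m. b j \<notin> D x}) \<le> (1 - \<theta>) ^ m * real (card X)"
proof (induction m)
  case 0
  then show ?case by simp
next
  case (Suc m)
  then obtain b where b: "\<forall>j<m. G (b j)"
    "real (card {x\<in>X. \<forall>j<m. b j \<notin> D x}) \<le> (1 - \<theta>) ^ m * real (card X)" by blast
  let ?Y = "{x\<in>X. \<forall>j<m. b j \<notin> D x}"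
  obtain v where v: "G v" "real (card {x\<in>?Y. v \<notin> D x}) \<le> (1 - \<theta>) * real (card ?Y)"
    using ex_point_in_many_events[of ?Y D \<theta> G] fin D G by auto
  have "{x\<in>X. \<forall>j<Suc m. (b(m := v)) j \<notin> D x} = {x\<in>?Y. v \<notin> D x}"
    by (auto simp: less_Suc_eq)
  then have "real (card {x\<in>X. \<forall>j<Suc m. (b(m := v)) j \<notin> D x}) \<le> (1 - \<theta>) * real (card ?Y)"
    using v(2) by simp
  also have "\<dots> \<le> (1 - \<theta>) * ((1 - \<theta>) ^ m * real (card X))"
    using b(2) \<theta> by (intro mult_left_mono) auto
  finally show ?case
    using b(1) v(1) by (intro exI[of _ "b(m := v)"]) (auto simp: less_Suc_eq mult.assoc)
qed

text \<open>The events to be hit are indexed by ordered pairs of distinct points of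
  \<open>A\<close>. By \<open>small\<close>, fewer than one pair, hence none, stays undistinguished
  after \<open>m\<close> greedy choices.\<close>

lemma (in prob_space) ex_separating_sample:
  assumes fin: "finite A"
    and meas: "\<And>x y. x \<in> A \<Longrightarrow> y \<in> A \<Longrightarrow> {b \<in> space M. L x b \<noteq> L y b} \<in> events"
    and sep: "\<And>x y. x \<in> A \<Longrightarrow> y \<in> A \<Longrightarrow> x \<noteq> y \<Longrightarrow> \<theta> \<le> prob {b \<in> space M. L x b \<noteq> L y b}"
    and \<theta>: "\<theta> \<le> 1" and small: "(1 - \<theta>) ^ m * real (card A ^ 2) < 1"
    and G: "AE b in M. G b"
  shows "\<exists>b. (\<forall>j<m. G (b j)) \<and> (\<forall>x\<in>A. \<forall>y\<in>A. x \<noteq> y \<longrightarrow> (\<exists>j<m. L x (b j) \<noteq> L y (b j)))"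
proof -
  define X where "X = {z \<in> A \<times> A. fst z \<noteq> snd z}"
  define D where "D z = {b \<in> space M. L (fst z) b \<noteq> L (snd z) b}" for z
  have finX: "finite X" using fin by (simp add: X_def)
  have "card X \<le> card (A \<times> A)" using fin by (intro card_mono) (auto simp: X_def)
  then have cardX: "card X \<le> card A ^ 2" by (simp add: card_cartesian_product power2_eq_square)
  obtain b where b: "\<forall>j<m. G (b j)"
    "real (card {z\<in>X. \<forall>j<m. b j \<notin> D z}) \<le> (1 - \<theta>) ^ m * real (card X)"
    using greedy_hitting_set[OF finX, of D \<theta> G m] meas sep \<theta> G by (auto simp: X_def D_def)
  have "(1 - \<theta>) ^ m * real (card X) \<le> (1 - \<theta>) ^ m * real (card A ^ 2)"
    using cardX \<theta> by (intro mult_left_mono) auto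
  with b(2) small have "card {z\<in>X. \<forall>j<m. b j \<notin> D z} = 0" by linarith
  then have "{z\<in>X. \<forall>j<m. b j \<notin> D z} = {}" using finX by simp
  then have "\<exists>j<m. L x (b j) \<noteq> L y (b j)" if "x \<in> A" "y \<in> A" "x \<noteq> y" for x y
  proof -
    have "(x, y) \<in> X" using that by (simp add: X_def)
    then have "\<exists>j<m. b j \<in> D (x, y)"
      using \<open>{z\<in>X. \<forall>j<m. b j \<notin> D z} = {}\<close> by blast
    then show ?thesis by (auto simp: D_def)
  qed
  then show ?thesis using b(1) by blast
qed

section \<open>Counting representable labelings\<close>

text \<open>The points are chosen in order. On an edge the earlier vertex is always the first
  argument, so the new point only has to avoid finitely many null sets determined by the earlier
  points.\<close>

lemma ex_generic_points:
  assumes AE: "\<And>a. a \<in> U \<Longrightarrow> AE b in lborel. nondeg k P a b"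
    and V: "\<And>i. i \<in> {1..n} \<Longrightarrow> open (V i) \<and> V i \<noteq> {} \<and> V i \<subseteq> U"
  shows "\<exists>x. (\<forall>i\<in>{1..n}. x i \<in> V i) \<and> (\<forall>(i, j)\<in>edges n. nondeg k P (x i) (x j))"
  using V
proof (induction n)
  case 0
  then show ?case by (auto simp: edges_def)
next
  case (Suc n)
  then obtain x where x: "\<forall>i\<in>{1..n}. x i \<in> V i" "\<forall>(i, j)\<in>edges n. nondeg k P (x i) (x j)"
    by fastforce
  have "AE b in lborel. \<forall>i\<in>{1..n}. nondeg k P (x i) b"
  proof (rule AE_finite_allI)
    fix i assume i: "i \<in> {1..n}"
    then have "x i \<in> V i" "V i \<subseteq> U" using x(1) Suc.prems[of i] by auto
    then show "AE b in lborel. nondeg k P (x i) b" by (intro AE) auto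
  qed simp
  then have "\<exists>v\<in>V (Suc n). \<forall>i\<in>{1..n}. nondeg k P (x i) v"
    by (rule AE_lborel_open_ex) (use Suc.prems[of "Suc n"] in auto)
  then obtain v where v: "v \<in> V (Suc n)" "\<forall>i\<in>{1..n}. nondeg k P (x i) v"
    by blast
  have "(x(Suc n := v)) i \<in> V i" if "i \<in> {1..Suc n}" for i
    using that x(1) v(1) by (cases "i = Suc n") auto
  moreover have "nondeg k P ((x(Suc n := v)) i) ((x(Suc n := v)) j)" if "(i, j) \<in> edges (Suc n)" for i j
  proof (cases "j = Suc n")
    case True
    then show ?thesis using that v(2) by (auto simp: edges_def)
  next
    case False
    then have "(i, j) \<in> edges n" using that by (auto simp: edges_def)
    then show ?thesis using x(2) by (auto simp: edges_def)
  qed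
  ultimately show ?case by (intro exI[of _ "x(Suc n := v)"]) blast
qed

lemma signvec_eq_on_balls:
  assumes "\<forall>s<k. poly_R2d (P s)" "nondeg k P a b"
  shows "\<exists>e>0. \<forall>x\<in>ball a e. \<forall>y\<in>ball b e. signvec k P x y = signvec k P a b"
proof -
  obtain Q1 Q2 where Q: "eventually Q1 (nhds a)" "eventually Q2 (nhds b)"
    "\<And>x y. Q1 x \<Longrightarrow> Q2 y \<Longrightarrow> signvec k P x y = signvec k P a b"
    using eventually_signvec_eq[OF assms] unfolding nhds_prod eventually_prod_filter by auto
  obtain e1 where "0 < e1" "\<forall>x. dist x a < e1 \<longrightarrow> Q1 x"
    using Q(1) unfolding eventually_nhds_metric by blast
  moreover obtain e2 where "0 < e2" "\<forall>y. dist y b < e2 \<longrightarrow> Q2 y"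
    using Q(2) unfolding eventually_nhds_metric by blast
  ultimately have "0 < min e1 e2"
    "\<forall>x\<in>ball a (min e1 e2). \<forall>y\<in>ball b (min e1 e2). Q1 x \<and> Q2 y"
    by (auto simp: dist_commute)
  then show ?thesis using Q(3) by blast
qed

text \<open>The minimum of finitely many radii gives one radius within which all points of a
  configuration can be perturbed at once.\<close>

lemma signvec_eq_on_balls_finite:
  fixes P :: "nat \<Rightarrow> (real^'d) \<times> (real^'d) \<Rightarrow> real"
  assumes polys: "\<forall>s<k. poly_R2d (P s)" and fin: "finite S"
    and nd: "\<And>a b. (a, b) \<in> S \<Longrightarrow> nondeg k P a b"
  shows "\<exists>e>0. \<forall>a b. (a, b) \<in> S \<longrightarrow>
    (\<forall>x\<in>ball a e. \<forall>y\<in>ball b e. signvec k P x y = signvec k P a b)"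
  using fin nd
proof (induction S)
  case empty
  then show ?case by (auto intro: exI[of _ 1])
next
  case (insert z S)
  obtain a b where z: "z = (a, b)" by fastforce
  have "\<exists>e>0. \<forall>a b. (a, b) \<in> S \<longrightarrow>
    (\<forall>x\<in>ball a e. \<forall>y\<in>ball b e. signvec k P x y = signvec k P a b)"
    by (rule insert.IH) (rule insert.prems, simp)
  then obtain e1 where e1: "0 < e1" "\<forall>a b. (a, b) \<in> S \<longrightarrow>
    (\<forall>x\<in>ball a e1. \<forall>y\<in>ball b e1. signvec k P x y = signvec k P a b)" by blast
  have "nondeg k P a b" by (rule insert.prems) (simp add: z)
  then obtain e2 where e2: "0 < e2" "\<forall>x\<in>ball a e2. \<forall>y\<in>ball b e2. signvec k P x y = signvec k P a b"
    using signvec_eq_on_balls[OF polys] by blast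
  have "ball c (min e1 e2) \<subseteq> ball c e1" "ball c (min e1 e2) \<subseteq> ball c e2" for c :: "real^'d"
    by auto
  then have "\<forall>a' b'. (a', b') \<in> insert z S \<longrightarrow>
    (\<forall>x\<in>ball a' (min e1 e2). \<forall>y\<in>ball b' (min e1 e2). signvec k P x y = signvec k P a' b')"
    using e1(2) e2(2) unfolding z by blast
  moreover have "0 < min e1 e2" using e1(1) e2(1) by simp
  ultimately show ?case by blast
qed

text \<open>Since \<open>card\<close> is 0 on infinite sets, finiteness is what lets an injection
  into this set bound its cardinality from below.\<close>

lemma finite_strongly_rep:
  fixes \<phi> :: "sign list \<Rightarrow> 'l::finite"
  shows "finite (strongly_rep k P \<phi> U n)"
proof (rule finite_subset)
  have "edges n \<subseteq> {0..n} \<times> {0..n}" by (auto simp: edges_def)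
  then have "finite (edges n)" by (rule finite_subset) simp
  then show "finite (PiE (edges n) (\<lambda>_. UNIV :: 'l set))" by (intro finite_PiE) auto
  show "strongly_rep k P \<phi> U n \<subseteq> PiE (edges n) (\<lambda>_. UNIV)"
    by (auto simp: strongly_rep_def)
qed

text \<open>The first \<open>n - m\<close> vertices choose freely from \<open>A\<close>, with
  repetitions allowed, and the last \<open>m\<close> vertices are the test points. The labels
  between the two groups reveal every choice.\<close>

lemma card_strongly_rep_ge:
  fixes \<phi> :: "sign list \<Rightarrow> 'l::finite" and U :: "(real^'d) set"
  assumes polys: "\<forall>s<k. poly_R2d (P s)"
    and U: "open U"
    and AE: "\<And>a. a \<in> U \<Longrightarrow> AE b in lborel. nondeg k P a b"
    and A: "finite A" "A \<subseteq> U" and b: "\<forall>j<m. b j \<in> U"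
    and nd: "\<forall>a\<in>A. \<forall>j<m. nondeg k P a (b j)"
    and sep: "\<forall>x\<in>A. \<forall>y\<in>A. x \<noteq> y \<longrightarrow> (\<exists>j<m. \<phi> (signvec k P x (b j)) \<noteq> \<phi> (signvec k P y (b j)))"
    and mn: "m \<le> n"
  shows "card A ^ (n - m) \<le> card (strongly_rep k P \<phi> U n)"
proof -
  define N where "N = n - m"
  define H where "H = PiE {1..N} (\<lambda>_. A)"
  define S where "S = (\<lambda>(a, j). (a, b j)) ` (A \<times> {..<m})"
  have "finite S" using A by (simp add: S_def)
  moreover have "nondeg k P a b'" if "(a, b') \<in> S" for a b'
    using that nd by (auto simp: S_def)
  ultimately obtain e where e: "0 < e"
    "\<forall>a b. (a, b) \<in> S \<longrightarrow>
      (\<forall>x\<in>ball a e. \<forall>y\<in>ball b e. signvec k P x y = signvec k P a b)"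
    using signvec_eq_on_balls_finite[OF polys, of S] by blast
  have "\<exists>l\<in>strongly_rep k P \<phi> U n. \<forall>i\<in>{1..N}. \<forall>j<m. l (i, N + 1 + j) = \<phi> (signvec k P (g i) (b j))"
    if g: "g \<in> H" for g
  proof -
    \<comment> \<open>Vertices are numbered from 1 and test points from 0, so vertex
      \<open>N + 1 + j\<close> carries \<open>b j\<close>.\<close>
    define c where "c i = (if i \<le> N then g i else b (i - N - 1))" for i
    have cU: "c i \<in> U" if "i \<in> {1..n}" for i
      using that g A b by (auto simp: c_def H_def N_def PiE_iff)
    \<comment> \<open>Edges inside either group may be degenerate, for instance when a point is
      repeated. Moving each point by less than \<open>e\<close> repairs them without changing any
      label between a choice and a test point.\<close>
    have "\<exists>x. (\<forall>i\<in>{1..n}. x i \<in> ball (c i) e \<inter> U) \<and> (\<forall>(i, j)\<in>edges n. nondeg k P (x i) (x j))"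
    proof (rule ex_generic_points[OF AE])
      fix i assume "i \<in> {1..n}"
      then have "c i \<in> ball (c i) e \<inter> U" using cU e(1) by simp
      then show "open (ball (c i) e \<inter> U) \<and> ball (c i) e \<inter> U \<noteq> {} \<and> ball (c i) e \<inter> U \<subseteq> U"
        using U by blast
    qed
    then obtain x where x: "\<And>i. i \<in> {1..n} \<Longrightarrow> x i \<in> ball (c i) e \<inter> U"
      "\<forall>(i, j)\<in>edges n. nondeg k P (x i) (x j)" by blast
    let ?l = "\<lambda>e\<in>edges n. \<phi> (signvec k P (x (fst e)) (x (snd e)))"
    have "?l \<in> strongly_rep k P \<phi> U n"
      unfolding strongly_rep_def mem_Collect_eq
    proof (intro exI[of _ x] conjI refl)
      show "\<forall>i\<in>{1..n}. x i \<in> U" using x(1) by blast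
      show "\<forall>(i, j)\<in>edges n. \<forall>s<k. P s (x i, x j) \<noteq> 0" using x(2) by (simp only: nondeg_def)
    qed
    moreover have "?l (i, N + 1 + j) = \<phi> (signvec k P (g i) (b j))" if ij: "i \<in> {1..N}" "j < m" for i j
    proof -
      have n: "i \<in> {1..n}" "N + 1 + j \<in> {1..n}" "(i, N + 1 + j) \<in> edges n"
        using ij mn by (auto simp: edges_def N_def)
      have "c i = g i" "c (N + 1 + j) = b j" using ij by (auto simp: c_def)
      then have "x i \<in> ball (g i) e" "x (N + 1 + j) \<in> ball (b j) e"
        using x(1)[OF n(1)] x(1)[OF n(2)] by auto
      moreover have "(g i, b j) \<in> S" using g ij by (auto simp: S_def H_def)
      ultimately have "signvec k P (x i) (x (N + 1 + j)) = signvec k P (g i) (b j)"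
        using e(2) by blast
      then show ?thesis using n(3) by simp
    qed
    ultimately show ?thesis by blast
  qed
  then obtain F where F: "\<And>g. g \<in> H \<Longrightarrow> F g \<in> strongly_rep k P \<phi> U n"
    "\<And>g i j. g \<in> H \<Longrightarrow> i \<in> {1..N} \<Longrightarrow> j < m \<Longrightarrow> F g (i, N + 1 + j) = \<phi> (signvec k P (g i) (b j))"
    by metis
  \<comment> \<open>At each vertex \<open>i\<close> the labels towards the test points determine
    \<open>g i\<close> among the points of \<open>A\<close>, by \<open>sep\<close>.\<close>
  have "inj_on F H"
  proof (rule inj_onI)
    fix g g' assume g: "g \<in> H" "g' \<in> H" "F g = F g'"
    show "g = g'"
    proof (rule PiE_ext)
      show "g \<in> PiE {1..N} (\<lambda>_. A)" "g' \<in> PiE {1..N} (\<lambda>_. A)" using g by (auto simp: H_def)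
      fix i assume i: "i \<in> {1..N}"
      then have "\<phi> (signvec k P (g i) (b j)) = \<phi> (signvec k P (g' i) (b j))" if "j < m" for j
        using F(2) g that by metis
      moreover have "g i \<in> A" "g' i \<in> A" using i g by (auto simp: H_def)
      ultimately show "g i = g' i" using sep by metis
    qed
  qed
  then have "card H \<le> card (strongly_rep k P \<phi> U n)"
    using F(1) finite_strongly_rep by (intro card_inj_on_le) auto
  moreover have "card H = card A ^ (n - m)"
    by (simp add: H_def card_PiE N_def)
  ultimately show ?thesis by simp
qed

section \<open>Configurations with many separated points\<close>

text \<open>The real-valued \<open>measure\<close> is 0 on sets of infinite measure, so monotonicity
  needs the larger set to have finite measure; boundedness ensures this.\<close>

lemma measure_lborel_mono_bounded:
  assumes "A \<subseteq> B" "A \<in> sets borel" "B \<in> sets borel" "bounded B"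
  shows "measure lborel A \<le> measure lborel B"
  using assms emeasure_bounded_finite[of B]
  by (intro measure_mono_fmeasurable) (auto simp: fmeasurable_def)

lemma sets_label_neq:
  fixes \<phi> :: "sign list \<Rightarrow> 'l::finite"
  assumes "\<forall>s<k. poly_R2d (P s)"
  shows "{b. \<phi> (signvec k P x b) \<noteq> \<phi> (signvec k P y b)} \<in> sets borel"
proof -
  have "{b. \<phi> (signvec k P x b) = c} \<in> sets borel" for x c
    using measurable_sets[OF measurable_label[OF assms, of \<phi> x], of "{c}"] by (simp add: vimage_def)
  then have "(\<Union>c\<in>UNIV. {b. \<phi> (signvec k P x b) = c} - {b. \<phi> (signvec k P y b) = c}) \<in> sets borel"
    by (intro sets.finite_UN sets.Diff) auto
  moreover have "{b. \<phi> (signvec k P x b) \<noteq> \<phi> (signvec k P y b)} =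
      (\<Union>c\<in>UNIV. {b. \<phi> (signvec k P x b) = c} - {b. \<phi> (signvec k P y b) = c})" by auto
  ultimately show ?thesis by simp
qed

text \<open>A separating \<open>b\<close> keeps separating when \<open>b\<close>, \<open>x\<close>
  and \<open>y\<close> move slightly, so each pair has a neighbourhood with a common positive lower
  bound. Compactness of \<open>S\<close> makes the bound uniform.\<close>

lemma uniform_measure_separation:
  fixes \<phi> :: "sign list \<Rightarrow> 'l::finite" and U :: "(real^'d) set"
  assumes polys: "\<forall>s<k. poly_R2d (P s)" and U: "open U"
    and S: "compact S" "\<And>x y. (x, y) \<in> S \<Longrightarrow> \<exists>b\<in>U. nondeg k P x b \<and> nondeg k P y b \<and>
        \<phi> (signvec k P x b) \<noteq> \<phi> (signvec k P y b)"
  shows "\<exists>N::nat. \<forall>(x, y)\<in>S. inverse (real (Suc N)) \<le>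
      measure lborel {b \<in> U \<inter> ball 0 (real N). \<phi> (signvec k P x b) \<noteq> \<phi> (signvec k P y b)}"
proof -
  define L where "L a b = \<phi> (signvec k P a b)" for a b
  define D where "D N x y = {b \<in> U \<inter> ball 0 (real N). L x b \<noteq> L y b}" for N :: nat and x y
  have "{b \<in> U \<inter> ball 0 (real N). L x b \<noteq> L y b} = U \<inter> ball 0 (real N) \<inter> {b. L x b \<noteq> L y b}" for N x y
    by auto
  then have D_sets: "D N x y \<in> sets borel" for N x y
    unfolding D_def L_def using U sets_label_neq[OF polys, of \<phi> x y] by (auto intro!: sets.Int)
  have D_bdd: "bounded (D N x y)" for N x y
    by (rule bounded_subset[OF bounded_ball[of 0 "real N"]]) (auto simp: D_def)
  \<comment> \<open>One index serves both as truncation radius and as inverse lower bound. The sets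
    \<open>T N\<close> then increase with \<open>N\<close>, and a finite subcover reduces to its
    largest index.\<close>
  define T where "T N = {z. inverse (real (Suc N)) \<le> measure lborel (D N (fst z) (snd z))}" for N
  have T_mono: "T N \<subseteq> T N'" if "N \<le> N'" for N N'
  proof
    fix z assume "z \<in> T N"
    have "inverse (real (Suc N')) \<le> inverse (real (Suc N))" using that by (simp add: field_simps)
    also have "\<dots> \<le> measure lborel (D N (fst z) (snd z))" using \<open>z \<in> T N\<close> by (simp add: T_def)
    also have "\<dots> \<le> measure lborel (D N' (fst z) (snd z))"
      using that D_sets D_bdd by (intro measure_lborel_mono_bounded) (auto simp: D_def)
    finally show "z \<in> T N'" by (simp add: T_def)
  qed
  have cover: "S \<subseteq> (\<Union>N. interior (T N))"
  proof
    fix z assume "z \<in> S"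
    obtain x y where z: "z = (x, y)" by fastforce
    with \<open>z \<in> S\<close> S(2) obtain b where b: "b \<in> U" "nondeg k P x b" "nondeg k P y b" "L x b \<noteq> L y b"
      unfolding L_def by blast
    obtain e1 where e1: "0 < e1" "\<forall>x'\<in>ball x e1. \<forall>b'\<in>ball b e1. signvec k P x' b' = signvec k P x b"
      using signvec_eq_on_balls[OF polys b(2)] by blast
    obtain e2 where e2: "0 < e2" "\<forall>y'\<in>ball y e2. \<forall>b'\<in>ball b e2. signvec k P y' b' = signvec k P y b"
      using signvec_eq_on_balls[OF polys b(3)] by blast
    obtain e3 where e3: "0 < e3" "ball b e3 \<subseteq> U"
      using U b(1) open_contains_ball by blast
    define e where "e = min e1 (min e2 e3)"
    have e: "0 < e" "e \<le> e1" "e \<le> e2" "e \<le> e3" using e1 e2 e3 by (auto simp: e_def)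
    define \<mu> where "\<mu> = measure lborel (ball b e)"
    have "0 < \<mu>" using e content_ball_pos[of e b] by (simp add: \<mu>_def)
    obtain N1 where N1: "inverse (real (Suc N1)) < \<mu>" using reals_Archimedean[OF \<open>0 < \<mu>\<close>] by blast
    obtain N2 :: nat where N2: "norm b + e < real N2" using reals_Archimedean2 by blast
    define N where "N = max N1 N2"
    have N: "inverse (real (Suc N)) \<le> \<mu>"
    proof -
      have "inverse (real (Suc N)) \<le> inverse (real (Suc N1))" by (simp add: N_def field_simps)
      then show ?thesis using N1 by linarith
    qed
    have ballN: "ball b e \<subseteq> ball 0 (real N)"
    proof
      fix v assume "v \<in> ball b e"
      then have "dist b v < e" by simp
      moreover have "norm v \<le> norm b + dist b v" by norm
      moreover have "real N2 \<le> real N" by (simp add: N_def)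
      ultimately have "norm v < real N" using N2 by linarith
      then show "v \<in> ball 0 (real N)" by simp
    qed
    have "ball x e \<times> ball y e \<subseteq> T N"
    proof clarify
      fix x' y' assume xy: "x' \<in> ball x e" "y' \<in> ball y e"
      have "b' \<in> D N x' y'" if b': "b' \<in> ball b e" for b'
      proof -
        have "x' \<in> ball x e1" "y' \<in> ball y e2" "b' \<in> ball b e1" "b' \<in> ball b e2" "b' \<in> ball b e3"
          using xy b' e by auto
        then have "L x' b' = L x b" "L y' b' = L y b" "b' \<in> U"
          using e1(2) e2(2) e3(2) by (auto simp: L_def)
        then show ?thesis using b(4) ballN b' by (auto simp: D_def)
      qed
      then have "\<mu> \<le> measure lborel (D N x' y')"
        unfolding \<mu>_def using D_sets D_bdd by (intro measure_lborel_mono_bounded) auto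
      then show "(x', y') \<in> T N" using N by (simp add: T_def)
    qed
    moreover have "open (ball x e \<times> ball y e)" by (intro open_Times) auto
    ultimately have "ball x e \<times> ball y e \<subseteq> interior (T N)" by (rule interior_maximal)
    moreover have "z \<in> ball x e \<times> ball y e" using e by (simp add: z)
    ultimately show "z \<in> (\<Union>N. interior (T N))" by blast
  qed
  obtain I where I: "finite I" "S \<subseteq> (\<Union>N\<in>I. interior (T N))"
    by (rule compactE_image[OF S(1) _ cover]) auto
  define N where "N = Max (insert 0 I)"
  have "S \<subseteq> T N"
  proof
    fix z assume "z \<in> S"
    then obtain N0 where "N0 \<in> I" "z \<in> interior (T N0)" using I(2) by blast
    moreover have "N0 \<le> N" using \<open>N0 \<in> I\<close> I(1) by (simp add: N_def)
    ultimately show "z \<in> T N" using interior_subset T_mono by blast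
  qed
  then show ?thesis unfolding T_def D_def L_def by (intro exI[of _ N]) auto
qed

text \<open>A grid of \<open>r^d\<close> points at mutual \<open>\<rho>\<close>-distance at least
  \<open>\<kappa> / r\<close> has at most \<open>r^(2d)\<close> pairs to separate, and each test
  point can remove the fraction \<open>\<kappa> / r\<close> of those remaining. Hence order
  \<open>r ln r\<close> test points suffice.\<close>

lemma ex_separated_configuration:
  fixes \<phi> :: "sign list \<Rightarrow> 'l::finite" and U :: "(real^'d) set"
  assumes polys: "\<forall>s<k. poly_R2d (P s)" and U: "open U" "U \<noteq> {}"
    and AE: "\<And>a. a \<in> U \<Longrightarrow> AE b in lborel. nondeg k P a b"
    and sep: "\<And>a a'. a \<in> U \<Longrightarrow> a' \<in> U \<Longrightarrow> a \<noteq> a' \<Longrightarrow> \<exists>b\<in>U. nondeg k P a b \<and> nondeg k P a' b \<and>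
        \<phi> (signvec k P a b) \<noteq> \<phi> (signvec k P a' b)"
  shows "\<exists>C>0. \<forall>r m :: nat. 0 < r \<longrightarrow> C * real r * ln (real r) < real m \<longrightarrow>
      (\<exists>A b. finite A \<and> A \<subseteq> U \<and> card A = r ^ CARD('d) \<and> (\<forall>j<m. b j \<in> U) \<and>
        (\<forall>a\<in>A. \<forall>j<m. nondeg k P a (b j)) \<and>
        (\<forall>x\<in>A. \<forall>y\<in>A. x \<noteq> y \<longrightarrow> (\<exists>j<m. \<phi> (signvec k P x (b j)) \<noteq> \<phi> (signvec k P y (b j)))))"
proof -
  define L where "L a b = \<phi> (signvec k P a b)" for a b
  obtain u where "u \<in> U" using U by blast
  then obtain p q where pq: "cbox p q \<subseteq> U" "u \<in> box p q"
    using open_contains_cbox[OF U(1)] by metis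
  have lt: "p $ i < q $ i" for i
    using pq(2) by (auto simp: mem_box_cart intro: less_trans)
  have pK: "p \<in> cbox p q" and qK: "q \<in> cbox p q"
    using lt by (auto simp: mem_box_cart less_imp_le)
  \<comment> \<open>Pairs of points on opposite faces of the cube. They are distinct and form a
    compact set, so the separation hypothesis becomes uniform on it.\<close>
  define S where "S = (\<Union>i. (cbox p q \<inter> {x. x $ i = p $ i}) \<times> (cbox p q \<inter> {y. y $ i = q $ i}))"
  have "compact S"
    unfolding S_def
    by (intro compact_UN compact_Times compact_Int_closed compact_cbox closed_Collect_eq continuous_intros) auto
  moreover have "\<exists>b\<in>U. nondeg k P x b \<and> nondeg k P y b \<and> \<phi> (signvec k P x b) \<noteq> \<phi> (signvec k P y b)"
    if "(x, y) \<in> S" for x y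
  proof (rule sep)
    obtain i where "x $ i = p $ i" "y $ i = q $ i" using \<open>(x, y) \<in> S\<close> by (auto simp: S_def)
    then show "x \<noteq> y" using lt[of i] by auto
    show "x \<in> U" "y \<in> U" using that pq(1) by (auto simp: S_def)
  qed
  ultimately obtain N :: nat where N: "\<forall>(x, y)\<in>S. inverse (real (Suc N)) \<le>
      measure lborel {b \<in> U \<inter> ball 0 (real N). \<phi> (signvec k P x b) \<noteq> \<phi> (signvec k P y b)}"
    using uniform_measure_separation[OF polys U(1), of S \<phi>] by blast
  \<comment> \<open>\<open>U\<close> may have infinite measure; the bounded piece \<open>W\<close>
    carries a uniform probability measure.\<close>
  define W where "W = U \<inter> ball 0 (real N)"
  define w where "w = measure lborel W"
  have W: "W \<in> sets borel" "bounded W" using U by (auto simp: W_def intro: bounded_Int)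
  have W_D: "{b \<in> W. L x b \<noteq> L y b} = W \<inter> {b. L x b \<noteq> L y b}" for x y by auto
  have Dsets: "{b. L x b \<noteq> L y b} \<in> sets borel" for x y
    unfolding L_def by (rule sets_label_neq[OF polys])
  have NS: "inverse (real (Suc N)) \<le> measure lborel (W \<inter> {b. L x b \<noteq> L y b})" if "(x, y) \<in> S" for x y
    using N that unfolding W_def L_def W_D[unfolded W_def L_def, symmetric] by blast
  have "(p, q) \<in> S" using pK qK by (auto simp: S_def)
  from NS[OF this] have "0 < measure lborel (W \<inter> {b. L p b \<noteq> L q b})"
    by (rule less_le_trans[rotated]) simp
  also have "\<dots> \<le> w"
    unfolding w_def using W Dsets by (intro measure_lborel_mono_bounded) auto
  finally have w: "0 < w" .
  have emW: "emeasure lborel W \<noteq> 0" "emeasure lborel W \<noteq> \<infinity>"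
    using w emeasure_bounded_finite[OF W(2)] by (auto simp: w_def measure_def)
  define M where "M = uniform_measure lborel W"
  interpret M: prob_space M
    unfolding M_def by (rule prob_space_uniform_measure[OF emW])
  have spM: "space M = UNIV" and setsM: "sets M = sets borel" by (auto simp: M_def)
  define \<rho> where "\<rho> x y = measure M {b. L x b \<noteq> L y b}" for x y
  define \<kappa> where "\<kappa> = inverse (real (Suc N)) / w"
  have \<kappa>: "0 < \<kappa>" using w by (simp add: \<kappa>_def)
  have \<rho>S: "\<kappa> \<le> \<rho> x y" if "(x, y) \<in> S" for x y
  proof -
    have "\<rho> x y = measure lborel (W \<inter> {b. L x b \<noteq> L y b}) / w"
      unfolding \<rho>_def M_def w_def using Dsets by (intro measure_uniform_measure[OF emW]) simp
    then show ?thesis using NS[OF that] w by (simp add: \<kappa>_def divide_right_mono)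
  qed
  have AEM: "AE b in M. nondeg k P a b" if "a \<in> U" for a
    unfolding M_def
    by (rule AE_uniform_measureI) (use W AE[OF that] in \<open>auto elim: eventually_mono\<close>)
  have AEU: "AE b in M. b \<in> U"
    unfolding M_def
    by (rule AE_uniform_measureI) (use W in \<open>auto simp: W_def\<close>)
  \<comment> \<open>For almost every \<open>b\<close> the pair \<open>(a, b)\<close> is
    nondegenerate, so the labels of \<open>X n\<close> and \<open>a\<close> at \<open>b\<close>
    eventually agree. Dominated convergence then sends the probability of disagreement to 0.\<close>
  have cont: "(\<rho> a \<longlongrightarrow> 0) (at a within cbox p q)" if a: "a \<in> cbox p q" for a
    unfolding tendsto_at_iff_sequentially
  proof (intro allI impI)
    fix X :: "nat \<Rightarrow> real^'d" assume X: "X \<longlonglongrightarrow> a"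
    have "a \<in> U" using a pq by auto
    have "(\<lambda>n. \<integral>b. indicator {b. L a b \<noteq> L (X n) b} b \<partial>M) \<longlonglongrightarrow> (\<integral>b. (0::real) \<partial>M)"
    proof (rule integral_dominated_convergence[where w = "\<lambda>_. 1"])
      show "AE b in M. (\<lambda>n. indicator {b. L a b \<noteq> L (X n) b} b :: real) \<longlonglongrightarrow> 0"
        using AEM[OF \<open>a \<in> U\<close>]
      proof eventually_elim
        case (elim b)
        obtain e where e: "0 < e" "\<forall>x\<in>ball a e. \<forall>y\<in>ball b e. signvec k P x y = signvec k P a b"
          using signvec_eq_on_balls[OF polys elim] by blast
        have "\<forall>\<^sub>F n in sequentially. dist (X n) a < e"
          using X e(1) by (rule tendstoD)
        then have "\<forall>\<^sub>F n in sequentially. indicator {b. L a b \<noteq> L (X n) b} b = (0::real)"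
        proof eventually_elim
          case (elim n)
          then have "X n \<in> ball a e" "b \<in> ball b e" using e(1) by (auto simp: dist_commute)
          then have "L a b = L (X n) b" using e(2) unfolding L_def by metis
          then show ?case by simp
        qed
        then show ?case by (rule tendsto_eventually)
      qed
    qed (use Dsets setsM in \<open>auto simp: measurable_cong_sets[OF setsM refl] intro!: borel_measurable_indicator\<close>)
    then show "(\<rho> a \<circ> X) \<longlonglongrightarrow> 0"
      using Dsets by (simp add: o_def \<rho>_def setsM spM)
  qed
  have grid: "\<exists>A \<subseteq> cbox p q. finite A \<and> card A = r ^ CARD('d) \<and>
      (\<forall>x\<in>A. \<forall>y\<in>A. x \<noteq> y \<longrightarrow> \<kappa> / real r \<le> \<rho> x y)" if "0 < r" for r
  proof (rule separated_subset_of_cube[OF lt _ _ _ _ cont \<kappa> _ that])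
    show "0 \<le> \<rho> x y" for x y by (simp add: \<rho>_def)
    show "\<rho> x x = 0" for x by (simp add: \<rho>_def)
    show "\<rho> x y = \<rho> y x" for x y unfolding \<rho>_def by (rule arg_cong[where f = "measure M"]) auto
    show "\<rho> x z \<le> \<rho> x y + \<rho> y z" for x y z
    proof -
      have "\<rho> x z \<le> measure M ({b. L x b \<noteq> L y b} \<union> {b. L y b \<noteq> L z b})"
        unfolding \<rho>_def using Dsets setsM by (intro M.finite_measure_mono) auto
      also have "\<dots> \<le> \<rho> x y + \<rho> y z"
        unfolding \<rho>_def using Dsets setsM by (intro measure_Un_le) auto
      finally show ?thesis .
    qed
    show "\<kappa> \<le> \<rho> x y" if "x \<in> cbox p q" "y \<in> cbox p q" "x $ i = p $ i" "y $ i = q $ i" for x y i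
      using that by (intro \<rho>S) (auto simp: S_def)
  qed
  \<comment> \<open>With this constant the decay \<open>exp (- \<kappa> * m / r)\<close> beats the
    number \<open>r^(2d) = exp (2 * d * ln r)\<close> of pairs.\<close>
  define C where "C = 2 * real CARD('d) / \<kappa>"
  have "\<exists>A b. finite A \<and> A \<subseteq> U \<and> card A = r ^ CARD('d) \<and> (\<forall>j<m. b j \<in> U) \<and>
        (\<forall>a\<in>A. \<forall>j<m. nondeg k P a (b j)) \<and>
        (\<forall>x\<in>A. \<forall>y\<in>A. x \<noteq> y \<longrightarrow> (\<exists>j<m. L x (b j) \<noteq> L y (b j)))"
    if r: "0 < r" and m: "C * real r * ln (real r) < real m" for r m :: nat
  proof -
    obtain A where A: "A \<subseteq> cbox p q" "finite A" "card A = r ^ CARD('d)"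
      "\<And>x y. x \<in> A \<Longrightarrow> y \<in> A \<Longrightarrow> x \<noteq> y \<Longrightarrow> \<kappa> / real r \<le> \<rho> x y"
      using grid[OF r] by metis
    have "A \<subseteq> U" using A(1) pq(1) by blast
    have "\<kappa> \<le> 1" using \<rho>S[OF \<open>(p, q) \<in> S\<close>] M.prob_le_1 unfolding \<rho>_def by (rule order_trans)
    then have \<theta>: "\<kappa> / real r \<le> 1" using r \<kappa> by (simp add: field_simps)
    have cardA: "real (card A ^ 2) = exp (2 * real CARD('d) * ln (real r))"
    proof -
      have "real (card A ^ 2) = real r ^ (2 * CARD('d))"
        by (simp add: A(3) power_mult mult.commute flip: power_mult)
      also have "\<dots> = exp (real (2 * CARD('d)) * ln (real r))"
        using r by (simp add: exp_of_nat_mult del: of_nat_mult)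
      finally show ?thesis by simp
    qed
    have "(1 - \<kappa> / real r) ^ m \<le> exp (- (\<kappa> / real r)) ^ m"
      using \<theta> exp_ge_add_one_self[of "- (\<kappa> / real r)"] by (intro power_mono) auto
    also have "\<dots> = exp (- (\<kappa> / real r) * real m)"
      by (simp add: mult.commute flip: exp_of_nat_mult)
    finally have "(1 - \<kappa> / real r) ^ m * real (card A ^ 2) \<le> exp (- (\<kappa> / real r) * real m) * real (card A ^ 2)"
      by (rule mult_right_mono) simp
    also have "exp (- (\<kappa> / real r) * real m) * real (card A ^ 2) = exp (2 * real CARD('d) * ln (real r) - (\<kappa> / real r) * real m)"
      unfolding cardA by (simp add: exp_diff exp_minus field_simps)
    also have "\<dots> < exp 0"
    proof -
      have "(\<kappa> / real r) * (C * real r * ln (real r)) < (\<kappa> / real r) * real m"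
        using m \<kappa> r by (intro mult_strict_left_mono) auto
      then show ?thesis using \<kappa> r by (simp add: C_def)
    qed
    finally have small: "(1 - \<kappa> / real r) ^ m * real (card A ^ 2) < 1" by simp
    have "AE b in M. \<forall>a\<in>A. nondeg k P a b"
      using A(2) AEM \<open>A \<subseteq> U\<close> by (intro AE_finite_allI) auto
    then have G: "AE b in M. b \<in> U \<and> (\<forall>a\<in>A. nondeg k P a b)"
      using AEU by eventually_elim auto
    have "\<exists>b. (\<forall>j<m. b j \<in> U \<and> (\<forall>a\<in>A. nondeg k P a (b j))) \<and>
        (\<forall>x\<in>A. \<forall>y\<in>A. x \<noteq> y \<longrightarrow> (\<exists>j<m. L x (b j) \<noteq> L y (b j)))"
    proof (rule M.ex_separating_sample[OF A(2) _ _ \<theta> small G])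
      show "{b \<in> space M. L x b \<noteq> L y b} \<in> M.events" for x y
        using Dsets by (simp add: spM setsM)
      show "\<kappa> / real r \<le> M.prob {b \<in> space M. L x b \<noteq> L y b}" if "x \<in> A" "y \<in> A" "x \<noteq> y" for x y
        using A(4)[OF that] by (simp add: \<rho>_def spM)
    qed
    then obtain b where "\<forall>j<m. b j \<in> U \<and> (\<forall>a\<in>A. nondeg k P a (b j))"
      "\<forall>x\<in>A. \<forall>y\<in>A. x \<noteq> y \<longrightarrow> (\<exists>j<m. L x (b j) \<noteq> L y (b j))" by blast
    then show ?thesis
      using A(2,3) \<open>A \<subseteq> U\<close> by (intro exI[of _ A] exI[of _ b]) simp
  qed
  then show ?thesis
    unfolding L_def using \<kappa> by (intro exI[of _ C]) (auto simp: C_def)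
qed

section \<open>The asymptotic bound\<close>

text \<open>Here \<open>C * r * ln r\<close> is of order \<open>n / (ln n)^2\<close>, below
  \<open>m\<close> of order \<open>n / ln n\<close>. Also \<open>m / n\<close> tends to 0 and
  \<open>ln r / ln n\<close> tends to 1, so the exponent loses only a vanishing fraction. The error
  \<open>\<epsilon>\<close> is defined so that the count is an exact power of
  \<open>n\<close>.\<close>

lemma eventually_choice_of_parameters:
  fixes C :: real
  defines "r \<equiv> \<lambda>n::nat. nat \<lfloor>real n / ln (real n) ^ 3\<rfloor>"
    and "m \<equiv> \<lambda>n::nat. nat \<lceil>real n / ln (real n)\<rceil>"
  defines "\<epsilon> \<equiv> \<lambda>n. 1 - ln (real (r n)) / ln (real n) * (1 - real (m n) / real n)"
  assumes "0 < C"
  shows "\<epsilon> \<longlonglongrightarrow> 0" (is ?lim)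
    and "\<forall>\<^sub>F n in sequentially. 0 < r n \<and> m n \<le> n \<and> C * real (r n) * ln (real (r n)) < real (m n)" (is ?ev)
    and "\<forall>\<^sub>F n in sequentially. real ((r n ^ d) ^ (n - m n)) = real n powr ((1 - \<epsilon> n) * real d * real n)" (is ?eq)
proof -
  \<comment> \<open>For \<open>n > 1\<close> both quotients are nonnegative, so the conversions to
    \<open>nat\<close> disappear and the asymptotics concern only real floors and ceilings.\<close>
  have R: "\<forall>\<^sub>F n::nat in sequentially. real (r n) = of_int \<lfloor>real n / ln (real n) ^ 3\<rfloor>"
    unfolding r_def using eventually_gt_at_top[of 1] by eventually_elim simp
  have M: "\<forall>\<^sub>F n::nat in sequentially. real (m n) = of_int \<lceil>real n / ln (real n)\<rceil>"
    unfolding m_def using eventually_gt_at_top[of 1] by eventually_elim simp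
  have "(\<lambda>n::nat. 1 - ln (of_int \<lfloor>real n / ln (real n) ^ 3\<rfloor>) / ln (real n) *
      (1 - of_int \<lceil>real n / ln (real n)\<rceil> / real n)) \<longlonglongrightarrow> 0"
    by real_asymp
  moreover have "\<forall>\<^sub>F n in sequentially. 1 - ln (of_int \<lfloor>real n / ln (real n) ^ 3\<rfloor>) / ln (real n) *
      (1 - of_int \<lceil>real n / ln (real n)\<rceil> / real n) = \<epsilon> n"
    using R M by eventually_elim (simp add: \<epsilon>_def)
  ultimately show ?lim
    by (rule Lim_transform_eventually)
  have 1: "\<forall>\<^sub>F n::nat in sequentially. 0 < \<lfloor>real n / ln (real n) ^ 3\<rfloor>"
    by real_asymp
  have 2: "\<forall>\<^sub>F n::nat in sequentially. of_int \<lceil>real n / ln (real n)\<rceil> \<le> real n"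
    by real_asymp
  have 3: "\<forall>\<^sub>F n::nat in sequentially. C * of_int \<lfloor>real n / ln (real n) ^ 3\<rfloor> *
      ln (of_int \<lfloor>real n / ln (real n) ^ 3\<rfloor>) < of_int \<lceil>real n / ln (real n)\<rceil>"
    using \<open>0 < C\<close> by real_asymp
  show ev: ?ev
    using R M 1 2 3
  proof eventually_elim
    case (elim n)
    have "0 < r n" using elim(3) by (simp add: r_def)
    moreover have "m n \<le> n" using elim(2,4) by linarith
    moreover have "C * real (r n) * ln (real (r n)) < real (m n)"
      unfolding elim(1,2) by (rule elim(5))
    ultimately show ?case by blast
  qed
  show ?eq
    using ev eventually_gt_at_top[of 1]
  proof eventually_elim
    case (elim n)
    then have "real ((r n ^ d) ^ (n - m n)) = real (r n) powr real (d * (n - m n))"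
      by (simp add: powr_realpow power_mult del: of_nat_mult)
    also have "\<dots> = exp (real d * (real n - real (m n)) * ln (real (r n)))"
      using elim by (simp add: powr_def of_nat_diff)
    also have "real d * (real n - real (m n)) * ln (real (r n)) = (1 - \<epsilon> n) * real d * real n * ln (real n)"
      using elim by (simp add: \<epsilon>_def field_simps)
    also have "exp \<dots> = real n powr ((1 - \<epsilon> n) * real d * real n)"
      using elim by (simp add: powr_def)
    finally show ?case .
  qed
qed

theorem theorem1p5:
  fixes k :: nat
    and P :: "nat \<Rightarrow> (real^'d) \<times> (real^'d) \<Rightarrow> real"
    and \<phi> :: "sign list \<Rightarrow> 'l::finite"
    and U :: "(real^'d) set"
  assumes polys: "\<forall>s<k. poly_R2d (P s)"
    and U_nonempty: "U \<noteq> {}"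
    and U_open: "open U"
    and U_def: "definable_by_polys U"
    and sep: "\<forall>a\<in>U. \<forall>a'\<in>U. a \<noteq> a' \<longrightarrow>
               (\<exists>b\<in>U. (\<forall>s<k. P s (a, b) \<noteq> 0 \<and> P s (a', b) \<noteq> 0) \<and>
                       \<phi> (signvec k P a b) \<noteq> \<phi> (signvec k P a' b))"
  shows "\<exists>\<epsilon> :: nat \<Rightarrow> real. \<epsilon> \<longlonglongrightarrow> 0 \<and>
           (\<forall>\<^sub>F n in sequentially.
              real (card (strongly_rep k P \<phi> U n))
                \<ge> real n powr ((1 - \<epsilon> n) * real CARD('d) * real n))"
proof -
  have sep': "\<exists>b\<in>U. nondeg k P a b \<and> nondeg k P a' b \<and> \<phi> (signvec k P a b) \<noteq> \<phi> (signvec k P a' b)"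
    if "a \<in> U" "a' \<in> U" "a \<noteq> a'" for a a'
    using sep that unfolding nondeg_def by blast
  \<comment> \<open>A point of an open set in positive dimension is not isolated, so
    \<open>a\<close> has a distinct companion in \<open>U\<close>; separating the two yields a
    nondegenerate partner for \<open>a\<close>.\<close>
  have AE: "AE b in lborel. nondeg k P a b" if "a \<in> U" for a
  proof -
    have "a islimpt U" using that U_open by (simp add: interior_limit_point interior_open)
    then obtain a' where "a' \<in> U" "a \<noteq> a'" unfolding islimpt_def by blast
    then obtain b where "nondeg k P a b" using sep' \<open>a \<in> U\<close> by blast
    then show ?thesis by (rule AE_nondeg[OF polys])
  qed
  define conf where "conf r m \<longleftrightarrow>
      (\<exists>A b. finite A \<and> A \<subseteq> U \<and> card A = r ^ CARD('d) \<and> (\<forall>j<m. b j \<in> U) \<and>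
        (\<forall>a\<in>A. \<forall>j<m. nondeg k P a (b j)) \<and>
        (\<forall>x\<in>A. \<forall>y\<in>A. x \<noteq> y \<longrightarrow> (\<exists>j<m. \<phi> (signvec k P x (b j)) \<noteq> \<phi> (signvec k P y (b j)))))"
    for r m :: nat
  have "\<exists>C>0. \<forall>r m :: nat. 0 < r \<longrightarrow> C * real r * ln (real r) < real m \<longrightarrow> conf r m"
    unfolding conf_def by (rule ex_separated_configuration[OF polys U_open U_nonempty AE sep'])
  then obtain C where C: "0 < C"
    "\<And>r m :: nat. 0 < r \<Longrightarrow> C * real r * ln (real r) < real m \<Longrightarrow> conf r m" by blast
  define r where "r n = nat \<lfloor>real n / ln (real n) ^ 3\<rfloor>" for n
  define m where "m n = nat \<lceil>real n / ln (real n)\<rceil>" for n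
  define \<epsilon> where "\<epsilon> n = 1 - ln (real (r n)) / ln (real n) * (1 - real (m n) / real n)" for n
  note par = eventually_choice_of_parameters[OF C(1), folded r_def m_def, folded \<epsilon>_def]
  have "\<forall>\<^sub>F n in sequentially. real n powr ((1 - \<epsilon> n) * real CARD('d) * real n)
      \<le> real (card (strongly_rep k P \<phi> U n))"
    using par(2) par(3)[of "CARD('d)"]
  proof eventually_elim
    case (elim n)
    then have "conf (r n) (m n)" using C(2) by blast
    then obtain A b where A: "finite A" "A \<subseteq> U" "card A = r n ^ CARD('d)" "\<forall>j<m n. b j \<in> U"
        "\<forall>a\<in>A. \<forall>j<m n. nondeg k P a (b j)"
        "\<forall>x\<in>A. \<forall>y\<in>A. x \<noteq> y \<longrightarrow> (\<exists>j<m n. \<phi> (signvec k P x (b j)) \<noteq> \<phi> (signvec k P y (b j)))"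
      unfolding conf_def by (elim exE conjE)
    have "(r n ^ CARD('d)) ^ (n - m n) \<le> card (strongly_rep k P \<phi> U n)"
      using card_strongly_rep_ge[OF polys U_open AE A(1,2,4,5,6), of n] elim(1) unfolding A(3) by blast
    then have "real ((r n ^ CARD('d)) ^ (n - m n)) \<le> real (card (strongly_rep k P \<phi> U n))"
      by (rule of_nat_mono)
    then show ?case using elim(2) by linarith
  qed
  with par(1) show ?thesis by blast
qed

end
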